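(* For every natural number $m\equiv 2\pmod{12}$, the form $P_m(x,y,z)=p_m(x)+p_m(y)+p_m(z)$, where $p_m(x)=\frac{(m-2)x^2-(m-4)x}{2}$ and $x,y,z\in\mathbb{Z}$, is not almost universal; i.e., there are infinitely many natural numbers $n$ not of the form $P_m(x,y,z)$ with $x,y,z\in\mathbb{Z}$.
   Context: A form is almost universal if it represents all but finitely many natural numbers.
   Formalization: The formal theorem assumes m ≥ 3, which excludes only m = 2; there p_2(x) = x, so P_2(x,y,z) = x+y+z represents every natural number and the claim as stated fails. *)

theory Defs
  imports Main "HOL-Number_Theory.Cong"
begin

text \<open>Generalized \<open>m\<close>-gonal numbers: the argument \<open>x\<close> ranges over all integers.
  The division by two is exact, see \<open>two_times_polygonal\<close>.\<close>

definition polygonal :: "nat \<Rightarrow> int \<Rightarrow> int" where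
  "polygonal m x = ((int m - 2) * x ^ 2 - (int m - 4) * x) div 2"

lemma two_times_polygonal:
  "2 * polygonal m x = (int m - 2) * x ^ 2 - (int m - 4) * x"
proof -
  have "even ((int m - 2) * x ^ 2 - (int m - 4) * x)"
    by simp
  then show ?thesis
    unfolding polygonal_def by simp
qed

definition P :: "nat \<Rightarrow> int \<Rightarrow> int \<Rightarrow> int \<Rightarrow> int" where
  "P m x y z = polygonal m x + polygonal m y + polygonal m z"

definition represents :: "(int \<Rightarrow> int \<Rightarrow> int \<Rightarrow> int) \<Rightarrow> nat \<Rightarrow> bool" where
  "represents F n \<longleftrightarrow> (\<exists>x y z. F x y z = int n)"

definition almost_universal :: "(int \<Rightarrow> int \<Rightarrow> int \<Rightarrow> int) \<Rightarrow> bool" where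
  "almost_universal F \<longleftrightarrow> finite {n. \<not> represents F n}"

end

theory Submission
  imports Defs "HOL-Number_Theory.Residues"
begin

text \<open>
  Write \<open>m = 12K + 2\<close>. Completing the square in \<open>P m x y z = n\<close>, with
  \<open>l\<^sup>2 = 8Kn + (6K - 1)\<^sup>2\<close> and \<open>T = 4K(x + y + z) - 6K + 1\<close>, gives
  \<open>(l + T) (l - T) = 32K\<^sup>2 (a\<^sup>2 + ab + b\<^sup>2)\<close> where \<open>a = x - y\<close>, \<open>b = y - z\<close>.
  Primes congruent to 2 modulo 3 are inert for the form \<open>a\<^sup>2 + ab + b\<^sup>2\<close>, so a positive factor
  of such a value that is congruent to 2 modulo 3 shares one of these primes with its cofactor.
  For \<open>l = w\<^sup>2 + w + 1\<close> no such prime divides \<open>l\<close>, which makes the factors \<open>l + T\<close> and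
  \<open>(l - T) / 2\<close> free of common inert primes; if moreover 4 divides \<open>l + T\<close> and 3 divides
  \<open>w\<close>, the residues modulo 3 are contradictory. A Hensel argument supplies infinitely many
  such \<open>w\<close> for which \<open>n\<close> is an integer.
\<close>

text \<open>If \<open>q\<close> divided neither \<open>a\<close> nor \<open>b\<close>, then
  \<open>a ^ 3\<close> and \<open>b ^ 3\<close> would agree modulo \<open>q\<close>. Since
  \<open>q - 1\<close> has the form \<open>3 * j + 1\<close>, cubing is injective on units modulo
  \<open>q\<close>, so \<open>a\<close> and \<open>b\<close> agree and the form becomes
  \<open>3 * a^2\<close>, a unit.\<close>

lemma inert_prime_dvd_norm:
  fixes a b q :: int
  assumes q: "prime q" "q mod 3 = 2" and dvd: "q dvd a\<^sup>2 + a * b + b\<^sup>2"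
  shows "q dvd a"
proof (rule ccontr)
  assume na: "\<not> q dvd a"
  have nb: "\<not> q dvd b"
  proof
    assume "q dvd b"
    then have "q dvd a * b + b\<^sup>2" by (simp add: power2_eq_square)
    with dvd have "q dvd a\<^sup>2" by (metis add.assoc dvd_add_left_iff)
    with na q show False using prime_dvd_power by blast
  qed
  have q0: "q > 0" using q prime_gt_0_int by blast
  define p where "p = nat q"
  have p: "int p = q" "prime p" using q(1) q0 unfolding p_def
    by (simp, metis prime_int_nat_transfer)
  define j where "j = p div 3"
  have pj: "p - 1 = 3 * j + 1"
    using q(2) p(1) unfolding j_def by presburger
  have fermat: "[c ^ (3 * j + 1) = 1] (mod q)" if "\<not> q dvd c" for c :: int
  proof -
    have "residues q" using q(1) prime_gt_1_int by (simp add: residues_def)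
    moreover have "coprime c q"
      using that q(1) by (metis coprime_commute prime_imp_coprime)
    ultimately have "[c ^ totient p = 1] (mod q)"
      unfolding p_def by (rule residues.euler_theorem)
    then show ?thesis using pj totient_prime[OF p(2)] by simp
  qed
  have "a ^ 3 - b ^ 3 = (a - b) * (a\<^sup>2 + a * b + b\<^sup>2)"
    by (simp add: algebra_simps power2_eq_square power3_eq_cube)
  with dvd have "[a ^ 3 = b ^ 3] (mod q)"
    by (simp add: cong_iff_dvd_diff)
  then have cube: "[a ^ (3 * j) = b ^ (3 * j)] (mod q)"
    by (simp add: power_mult cong_pow)
  have "[a ^ (3 * j) * a = b ^ (3 * j) * b] (mod q)"
    using fermat[OF na] fermat[OF nb] by (simp add: mult.commute) (metis cong_sym cong_trans)
  moreover have "[b ^ (3 * j) * b = a ^ (3 * j) * b] (mod q)"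
    using cube cong_scalar_right cong_sym by blast
  ultimately have "[a ^ (3 * j) * a = a ^ (3 * j) * b] (mod q)"
    by (rule cong_trans)
  then have "q dvd a ^ (3 * j) * (a - b)"
    by (simp add: cong_iff_dvd_diff algebra_simps)
  then have "q dvd a - b"
    using na q(1) prime_dvd_mult_iff prime_dvd_power by blast
  moreover have "3 * a\<^sup>2 = (a\<^sup>2 + a * b + b\<^sup>2) + (a - b) * (2 * a + b)"
    by (simp add: algebra_simps power2_eq_square)
  ultimately have "q dvd 3 * a\<^sup>2"
    using dvd by (metis dvd_add dvd_mult2)
  then have "q dvd 3"
    using na q(1) prime_dvd_mult_iff prime_dvd_power by blast
  then have "q \<le> 3" by (simp add: zdvd_imp_le)
  with q0 q(2) have "q = 2" by presburger
  with \<open>q dvd 3\<close> show False by simp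
qed

text \<open>A product of primes congruent to 0 or 1 modulo 3 is never 2 modulo 3; the induction
  splits off one prime at a time.\<close>

lemma exists_inert_prime_divisor:
  fixes C :: int
  assumes "C > 0" "C mod 3 = 2"
  shows "\<exists>q. prime q \<and> q mod 3 = 2 \<and> q dvd C"
  using assms
proof (induction "nat C" arbitrary: C rule: less_induct)
  case less
  then have "\<not> is_unit C" by auto
  then obtain p where p: "prime p" "p dvd C"
    using less.prems prime_divisor_exists[of C] by auto
  then obtain D where D: "C = p * D" by blast
  have p1: "p > 1" using p prime_gt_1_int by blast
  have D0: "D > 0" using D less.prems p1 by (simp add: zero_less_mult_iff)
  have "p mod 3 = 0 \<or> p mod 3 = 1 \<or> p mod 3 = 2" by presburger
  then show ?case
  proof (elim disjE)
    assume "p mod 3 = 0"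
    then have "C mod 3 = 0" using D by auto
    with less.prems show ?thesis by simp
  next
    assume "p mod 3 = 1"
    then have "D mod 3 = 2" using less.prems(2) D by (metis mod_mult_left_eq mult_1)
    moreover have "nat D < nat C" using D D0 p1 by simp
    ultimately obtain q where "prime q" "q mod 3 = 2" "q dvd D"
      using less.hyps D0 by blast
    then show ?thesis using D by auto
  next
    assume "p mod 3 = 2"
    then show ?thesis using p by blast
  qed
qed

text \<open>Descent: an inert prime \<open>q\<close> of \<open>C\<close> divides both
  \<open>a\<close> and \<open>b\<close>, so \<open>q^2\<close> divides \<open>C * D\<close> and
  hence \<open>C\<close>. Cancelling \<open>q^2\<close>, which is 1 modulo 3, preserves the residue
  of \<open>C\<close> and all hypotheses.\<close>

lemma norm_factor_mod_3:
  fixes C D a b :: int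
  assumes "C > 0" "C * D = a\<^sup>2 + a * b + b\<^sup>2"
    and "\<And>q. prime q \<Longrightarrow> q mod 3 = 2 \<Longrightarrow> q dvd C \<Longrightarrow> \<not> q dvd D"
  shows "C mod 3 \<noteq> 2"
  using assms
proof (induction "nat C" arbitrary: C a b rule: less_induct)
  case less
  show ?case
  proof
    assume C2: "C mod 3 = 2"
    then obtain q where q: "prime q" "q mod 3 = 2" "q dvd C"
      using exists_inert_prime_divisor less.prems(1) by blast
    have nD: "\<not> q dvd D" using less.prems(3) q by blast
    have "q dvd a\<^sup>2 + a * b + b\<^sup>2" using q(3) less.prems(2) by (metis dvd_mult2)
    moreover from this have "q dvd b\<^sup>2 + b * a + a\<^sup>2" by (simp add: ac_simps)
    ultimately have "q dvd a" "q dvd b"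
      using inert_prime_dvd_norm[OF q(1,2)] by blast+
    then obtain a' b' where ab: "a = q * a'" "b = q * b'" by blast
    obtain C1 where C1: "C = q * C1" using q by blast
    have q1: "q > 1" using q prime_gt_1_int by blast
    have e: "q * (C1 * D) = q * (q * (a'\<^sup>2 + a' * b' + b'\<^sup>2))"
      using less.prems(2) ab C1 by (simp add: algebra_simps power2_eq_square)
    then have e1: "C1 * D = q * (a'\<^sup>2 + a' * b' + b'\<^sup>2)" using q1 by simp
    then have "q dvd C1" using nD q(1) by (metis dvd_triv_left prime_dvd_mult_iff)
    then obtain C' where C': "C1 = q * C'" by blast
    have e2: "C' * D = a'\<^sup>2 + a' * b' + b'\<^sup>2" using e1 C' q1 by simp
    have CC: "C = q * q * C'" using C1 C' by simp
    have pos: "C' > 0" using CC less.prems(1) q1 by (simp add: zero_less_mult_iff)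
    have "C' < q * q * C'" using pos q1
      by (metis less_1_mult mult.commute mult_less_cancel_left_pos mult_1_right)
    then have lt: "nat C' < nat C" using CC pos by simp
    have "q * q mod 3 = 1" using q(2) mod_mult_eq[of q 3 q] by simp
    then have "C' mod 3 = 2" using C2 CC by (metis mod_mult_left_eq mult_1)
    moreover have "C' mod 3 \<noteq> 2"
      using less.hyps[OF lt pos e2] less.prems(3) CC by auto
    ultimately show False by simp
  qed
qed

text \<open>The derivative \<open>2 * w + 1\<close> is odd, so roots lift through all powers of 2.
  Adding \<open>2 ^ Suc r * M\<close> to \<open>w\<close> flips the parity of the quotient
  \<open>u\<close> because \<open>M\<close> is odd; it keeps \<open>M dvd w\<close> and only
  increases \<open>w\<close>.\<close>

lemma hensel_quadratic:
  fixes M c L :: int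
  assumes "odd M" "M > 0" "even c"
  shows "\<exists>w\<ge>L. M dvd w \<and> 2 ^ Suc r dvd w\<^sup>2 + w + c"
proof (induction r)
  case 0
  have "M * \<bar>L\<bar> \<ge> L" using assms(2)
    by (smt (verit) mult_le_cancel_right1)
  \<comment> \<open>Modulo 2 every \<open>w\<close> is a root, so any large multiple of
    \<open>M\<close> will do.\<close>
  then show ?case using assms(3) by (intro exI[of _ "M * \<bar>L\<bar>"]) (auto simp: power2_eq_square)
next
  case (Suc r)
  let ?Q = "2 ^ Suc r :: int"
  obtain w u where w: "w \<ge> L" "M dvd w" "w\<^sup>2 + w + c = ?Q * u"
    using Suc.IH by (auto elim!: dvdE)
  show ?case
  proof (cases "even u")
    case True
    then obtain v where "u = 2 * v" by blast
    then have "w\<^sup>2 + w + c = 2 ^ Suc (Suc r) * v" using w by simp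
    then show ?thesis using w by (metis dvd_triv_left)
  next
    case False
    have "(w + ?Q * M)\<^sup>2 + (w + ?Q * M) + c = (w\<^sup>2 + w + c) + ?Q * (M * (2 * w + 1) + ?Q * M\<^sup>2)"
      by (simp add: algebra_simps power2_eq_square)
    also have "\<dots> = ?Q * (u + M * (2 * w + 1) + ?Q * M\<^sup>2)"
      using w(3) by (simp add: algebra_simps)
    finally have e: "(w + ?Q * M)\<^sup>2 + (w + ?Q * M) + c = ?Q * (u + M * (2 * w + 1) + ?Q * M\<^sup>2)" .
    have "even (u + M * (2 * w + 1) + ?Q * M\<^sup>2)" using False assms(1) by simp
    then obtain v where "u + M * (2 * w + 1) + ?Q * M\<^sup>2 = 2 * v" by blast
    with e have "(w + ?Q * M)\<^sup>2 + (w + ?Q * M) + c = 2 ^ Suc (Suc r) * v" by simp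
    moreover have "w + ?Q * M \<ge> L" using w(1) assms(2) by (smt (verit) mult_pos_pos zero_less_power)
    ultimately show ?thesis using w(2) by (metis dvd_add dvd_triv_left dvd_triv_right)
  qed
qed

text \<open>The left-hand side of the conclusion is \<open>P m x y z\<close> for
  \<open>m = 12 * K + 2\<close>, with the division by two carried out.\<close>

lemma not_represented:
  fixes K n w x y z :: int
  defines "l \<equiv> w\<^sup>2 + w + 1"
  assumes w: "3 dvd w" "4 dvd l + 1 + 2 * K"
    and n: "l\<^sup>2 = 8 * K * n + (6 * K - 1)\<^sup>2"
  shows "6 * K * (x\<^sup>2 + y\<^sup>2 + z\<^sup>2) - (6 * K - 1) * (x + y + z) \<noteq> n"
proof
  assume rep: "6 * K * (x\<^sup>2 + y\<^sup>2 + z\<^sup>2) - (6 * K - 1) * (x + y + z) = n"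
  define s where "s = x + y + z"
  define N where "N = (x - y)\<^sup>2 + (x - y) * (y - z) + (y - z)\<^sup>2"
  define T where "T = 4 * K * s - 6 * K + 1"
  have key: "(l + T) * (l - T) = 32 * K\<^sup>2 * N"
  proof -
    have "(l + T) * (l - T) = l\<^sup>2 - T\<^sup>2" by (simp add: algebra_simps power2_eq_square)
    also have "\<dots> = 32 * K\<^sup>2 * N"
      unfolding n rep[symmetric] T_def N_def s_def by (simp add: algebra_simps power2_eq_square)
    finally show ?thesis .
  qed
  have Ns: "N = s\<^sup>2 - 3 * (x * y + y * z + z * x)"
    unfolding N_def s_def by (simp add: algebra_simps power2_eq_square)
  have N0: "N \<ge> 0"
  proof -
    have "2 * N = (x - y)\<^sup>2 + (y - z)\<^sup>2 + (z - x)\<^sup>2"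
      unfolding N_def by (simp add: algebra_simps power2_eq_square)
    then show ?thesis by (smt (verit) zero_le_power2)
  qed
  have l3: "l mod 3 = 1" unfolding l_def using w(1)
    by (auto elim!: dvdE simp: power2_eq_square) presburger
  have "even (w * (w + 1))" by simp
  then have l_odd: "odd l" unfolding l_def by (simp add: power2_eq_square)
  have l_pos: "l > 0"
  proof -
    have "4 * l = (2 * w + 1)\<^sup>2 + 3" unfolding l_def by (simp add: algebra_simps power2_eq_square)
    then show ?thesis by (smt (verit) zero_le_power2)
  qed
  \<comment> \<open>Otherwise 3 divides \<open>l + T\<close>, hence \<open>K\<close> or
    \<open>N\<close>. As \<open>N\<close> is \<open>s^2\<close> modulo 3, it then divides
    \<open>K * s\<close>, which forces \<open>T\<close> to be 1 modulo 3.\<close>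
  have T3: "T mod 3 \<noteq> 2"
  proof
    assume T2: "T mod 3 = 2"
    have "3 dvd l + T" using T2 l3 by presburger
    then have "3 dvd 32 * K\<^sup>2 * N" using key by (metis dvd_mult2)
    then have "3 dvd K\<^sup>2 \<or> 3 dvd N"
      by (simp add: prime_dvd_mult_iff)
    then have "3 dvd K \<or> 3 dvd s"
      unfolding Ns by (auto simp: prime_dvd_power_iff dvd_diff_left_iff)
    then have "3 dvd K * s" by auto
    then show False using T2 unfolding T_def mult.assoc by presburger
  qed
  have C4: "4 dvd l + T"
  proof -
    have "l + T = (l + 1 + 2 * K) + 4 * (K * s - 2 * K)"
      unfolding T_def by (simp add: algebra_simps)
    then show ?thesis using w(2) by (metis dvd_add dvd_triv_left)
  qed
  \<comment> \<open>Halving the second factor turns \<open>32 * K^2\<close> into the square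
    \<open>(4 * K)^2\<close>, so that \<open>C * D\<close> is itself a value of the norm form. As
    \<open>C\<close> is divisible by 4 and \<open>l\<close> is odd, \<open>D\<close> is odd, which
    keeps the inert prime 2 from being common.\<close>
  define C where "C = l + T"
  define D where "D = (l - T) div 2"
  have D: "l - T = 2 * D" unfolding D_def using C4 by presburger
  have sum: "C + 2 * D = 2 * l" using D by (simp add: C_def)
  have D_odd: "odd D" using C4 l_odd sum unfolding C_def by presburger
  have prod: "C * D = 16 * K\<^sup>2 * N" using key unfolding C_def D by (simp add: algebra_simps)
  have C_nz: "C \<noteq> 0" using T3 l3 unfolding C_def by presburger
  have D_nz: "D \<noteq> 0" using D_odd by auto
  have "C * D \<ge> 0" using prod N0 by simp
  then have pos: "C > 0" "D > 0"
    using C_nz D_nz sum l_pos by (auto simp: zero_le_mult_iff)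
  have norm: "C * D = (4 * K * (x - y))\<^sup>2 + (4 * K * (x - y)) * (4 * K * (y - z))
      + (4 * K * (y - z))\<^sup>2"
    unfolding prod N_def by (simp add: algebra_simps power2_eq_square)
  have no_common: "\<not> q dvd D" if q: "prime q" "q mod 3 = 2" "q dvd C" for q
  proof
    assume "q dvd D"
    then have "q dvd 2 * l" using sum q(3) by (metis dvd_add dvd_mult)
    moreover have "\<not> q dvd 2"
    proof
      assume "q dvd 2"
      then have "q = 2" using q(1) primes_dvd_imp_eq two_is_prime by blast
      with \<open>q dvd D\<close> D_odd show False by simp
    qed
    ultimately have "q dvd l" using q(1) prime_dvd_mult_iff by blast
    \<comment> \<open>\<open>l\<close> is the norm form at the coprime pair 1 and \<open>w\<close>,
      so no inert prime divides it.\<close>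
    then have "q dvd 1\<^sup>2 + 1 * w + w\<^sup>2" unfolding l_def by (simp add: algebra_simps)
    then have "q dvd 1" using inert_prime_dvd_norm q by blast
    with q(1) show False using not_prime_unit by blast
  qed
  have "C mod 3 \<noteq> 2" by (rule norm_factor_mod_3[OF pos(1) norm no_common])
  moreover have "D mod 3 \<noteq> 2"
    by (rule norm_factor_mod_3[OF pos(2) norm[unfolded mult.commute[of C]]]) (use no_common in blast)
  \<comment> \<open>With \<open>l\<close> being 1 modulo 3, \<open>T\<close> being 0 makes
    \<open>D\<close> equal to 2 modulo 3, and \<open>T\<close> being 1 makes \<open>C\<close> equal
    to 2.\<close>
  ultimately show False using T3 l3 D unfolding C_def by presburger
qed

text \<open>With \<open>K = 2 ^ r * M\<close> and \<open>M\<close> odd, the divisibility by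
  \<open>8 * K\<close> is checked separately modulo \<open>M\<close>, where \<open>w = 0\<close>
  makes both squares 1, and modulo \<open>2 ^ (r + 3)\<close>, where \<open>l\<close> is taken close
  to \<open>- (1 + 2 * K)\<close>.\<close>

lemma exists_large_parameter:
  fixes K L :: int
  assumes K: "K > 0"
  shows "\<exists>w\<ge>L. 3 dvd w \<and> 4 dvd w\<^sup>2 + w + 1 + 1 + 2 * K
    \<and> 8 * K dvd (w\<^sup>2 + w + 1)\<^sup>2 - (6 * K - 1)\<^sup>2"
proof -
  obtain M r where M: "K = 2 ^ r * M" "odd M"
    using K multiplicity_decompose'[of K 2] by (metis less_irrefl odd_one)
  have M0: "M > 0" using K M by (simp add: zero_less_mult_iff)
  \<comment> \<open>The constant \<open>2 + 2 * K\<close> turns the quadratic into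
    \<open>l + 1 + 2 * K\<close>. The exponent \<open>r + 2\<close> suffices, since the factor
    \<open>l - 1 - 2 * K\<close> below supplies one more 2.\<close>
  obtain w where w: "w \<ge> L" "3 * M dvd w" "2 ^ Suc (Suc r) dvd w\<^sup>2 + w + (2 + 2 * K)"
    using hensel_quadratic[of "3 * M" "2 + 2 * K" L "Suc r"] M M0 by auto
  define l where "l = w\<^sup>2 + w + 1"
  have w3: "3 dvd w" and wM: "M dvd w" using w(2) by (auto dest: dvd_mult_left dvd_mult_right)
  have l2: "2 ^ Suc (Suc r) dvd l + 1 + 2 * K" using w(3) by (simp add: l_def algebra_simps)
  then have l4: "4 dvd l + 1 + 2 * K" by (rule dvd_trans[rotated]) simp
  have "even (l - 1 - 2 * K)" using l4 by presburger
  then have "2 ^ Suc (Suc r) * 2 dvd (l + 1 + 2 * K) * (l - 1 - 2 * K)"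
    using l2 by (intro mult_dvd_mono)
  \<comment> \<open>The squares of \<open>6 * K - 1\<close> and \<open>1 + 2 * K\<close> differ by
    \<open>8 * K * (4 * K - 2)\<close>.\<close>
  moreover have split: "l\<^sup>2 - (6 * K - 1)\<^sup>2
      = (l + 1 + 2 * K) * (l - 1 - 2 * K) - 2 ^ Suc (Suc r) * 2 * (M * (4 * K - 2))"
    using M(1) by (simp add: algebra_simps power2_eq_square)
  ultimately have d2: "2 ^ Suc (Suc r) * 2 dvd l\<^sup>2 - (6 * K - 1)\<^sup>2"
    by (metis dvd_diff dvd_triv_left)
  have "l\<^sup>2 - (6 * K - 1)\<^sup>2 = w * ((w + 1) * (l + 1)) + K * (12 - 36 * K)"
    unfolding l_def by (simp add: algebra_simps power2_eq_square)
  moreover have "M dvd w * ((w + 1) * (l + 1)) + K * (12 - 36 * K)"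
    using wM M(1) by (intro dvd_add dvd_mult2) auto
  ultimately have dM: "M dvd l\<^sup>2 - (6 * K - 1)\<^sup>2" by simp
  have "coprime (2 ^ Suc (Suc r) * 2) M" using M(2) by (simp del: power_Suc)
  with d2 dM have "2 ^ Suc (Suc r) * 2 * M dvd l\<^sup>2 - (6 * K - 1)\<^sup>2"
    by (rule divides_mult)
  then have "8 * K dvd l\<^sup>2 - (6 * K - 1)\<^sup>2" using M(1) by (simp add: algebra_simps)
  with w(1) w3 l4 show ?thesis unfolding l_def by blast
qed

theorem theorem1p5:
  fixes m :: nat
  assumes "m \<ge> 3" and "[m = 2] (mod 12)"
  shows "\<not> almost_universal (P m)"
proof
  assume "almost_universal (P m)"
  then obtain n0 where n0: "\<And>n. \<not> represents (P m) n \<Longrightarrow> n < n0"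
    unfolding almost_universal_def finite_nat_set_iff_bounded by blast
  define K where "K = int (m div 12)"
  have "m mod 12 = 2" using assms(2) by (simp add: cong_def)
  \<comment> \<open>The bound \<open>m \<ge> 3\<close> excludes \<open>m = 2\<close>, where the form
    is \<open>x + y + z\<close> and represents everything.\<close>
  then have m: "int m = 12 * K + 2" and K: "K > 0"
    using assms(1) unfolding K_def by presburger+
  \<comment> \<open>Chosen so that \<open>l - (6 * K - 1)\<close> alone is at least
    \<open>8 * K * n0\<close>, which pushes \<open>n\<close> past every exception.\<close>
  define L where "L = 8 * K * int n0 + 6 * K"
  obtain w where w: "w \<ge> L" "3 dvd w" "4 dvd w\<^sup>2 + w + 1 + 1 + 2 * K"
    "8 * K dvd (w\<^sup>2 + w + 1)\<^sup>2 - (6 * K - 1)\<^sup>2"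
    using exists_large_parameter[OF K] by blast
  define l where "l = w\<^sup>2 + w + 1"
  obtain n where n: "l\<^sup>2 - (6 * K - 1)\<^sup>2 = 8 * K * n" using w(4) unfolding l_def by blast
  have "l \<ge> L" using w(1) unfolding l_def by (smt (verit) zero_le_power2)
  have L6: "L \<ge> 6 * K" using K by (simp add: L_def)
  have "8 * K * int n0 \<le> l - (6 * K - 1)" using \<open>l \<ge> L\<close> by (simp add: L_def)
  also have "\<dots> \<le> (l - (6 * K - 1)) * (l + (6 * K - 1))"
    using \<open>l \<ge> L\<close> L6 K by (intro mult_le_cancel_left1[THEN iffD2]) auto
  also have "\<dots> = 8 * K * n" using n by (simp add: algebra_simps power2_eq_square)
  finally have n_ge: "int n0 \<le> n" using K by simp
  have "\<not> represents (P m) (nat n)"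
  proof
    assume "represents (P m) (nat n)"
    then obtain x y z where "P m x y z = n" using n_ge by (auto simp: represents_def)
    then have "2 * n = 2 * polygonal m x + 2 * polygonal m y + 2 * polygonal m z"
      by (simp add: P_def)
    then have "n = 6 * K * (x\<^sup>2 + y\<^sup>2 + z\<^sup>2) - (6 * K - 1) * (x + y + z)"
      unfolding two_times_polygonal m by (simp add: algebra_simps)
    moreover have "l\<^sup>2 = 8 * K * n + (6 * K - 1)\<^sup>2" using n by simp
    ultimately show False using not_represented w(2,3) unfolding l_def by metis
  qed
  from n0[OF this] n_ge show False by simp
qed

end
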